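(* Let $G$ be a graph. Then $G$ is $\{P_4,C_4\}$-free if and only if $\Gamma(H)=col(H)$ for every induced subgraph $H$ of $G$.
   Context: All graphs are finite and simple, and (induced sub)graphs have at least one vertex. $P_4$ is the path on 4 vertices and $C_4$ the cycle on 4 vertices; $G$ is $\{P_4,C_4\}$-free if no induced subgraph of $G$ is isomorphic to $P_4$ or $C_4$. A Grundy $k$-coloring of $G$ is a partition of $V(G)$ into $k$ nonempty independent sets $V_1,\dots,V_k$ such that for every $i$, every vertex $v\in V_i$ has at least one neighbor in each $V_j$ with $j<i$. The Grundy number $\Gamma(G)$ is the largest $k$ for which $G$ has a Grundy $k$-coloring. The coloring number $col(G)$ is the least integer $k$ such that $G$ has a vertex ordering in which each vertex is preceded by fewer than $k$ of its neighbors. *)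

theory Defs
  imports "Graph_Theory.Graph_Theory" "HOL-Library.Disjoint_Sets"
begin

text \<open>
  A finite simple graph is a symmetric, loop-free digraph without parallel arcs (the locale
  \<^locale>\<open>graph\<close>), an undirected edge being a pair of opposite arcs. That locale admits the graph
  without vertices.
\<close>

definition path_graph :: "nat \<Rightarrow> nat pair_pre_digraph" where
  "path_graph n =
    \<lparr>pverts = {0..<n},
     parcs = {(i, j). i < n \<and> j < n \<and> (j = i + 1 \<or> i = j + 1)}\<rparr>"

text \<open>This is the cycle on \<open>n\<close> vertices only for \<open>n \<ge> 3\<close>.\<close>

definition cycle_graph :: "nat \<Rightarrow> nat pair_pre_digraph" where
  "cycle_graph n =
    \<lparr>pverts = {0..<n},
     parcs = {(i, j). i < n \<and> j < n \<and> (j = (i + 1) mod n \<or> i = (j + 1) mod n)}\<rparr>"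

definition induced_free :: "('c, 'd) pre_digraph set \<Rightarrow> ('a, 'b) pre_digraph \<Rightarrow> bool" where
  "induced_free \<F> G \<longleftrightarrow>
    \<not> (\<exists>H F. induced_subgraph H G \<and> F \<in> \<F> \<and> digraph_iso H F)"

definition independent_set :: "('a, 'b) pre_digraph \<Rightarrow> 'a set \<Rightarrow> bool" where
  "independent_set G S \<longleftrightarrow> S \<subseteq> verts G \<and> (\<forall>u \<in> S. \<forall>v \<in> S. \<not> u \<rightarrow>\<^bsub>G\<^esub> v)"

text \<open>The classes are \<open>V 1, \<dots>, V k\<close>; values of \<open>V\<close> at other indices are irrelevant.\<close>

definition grundy_coloring :: "('a, 'b) pre_digraph \<Rightarrow> nat \<Rightarrow> (nat \<Rightarrow> 'a set) \<Rightarrow> bool" where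
  "grundy_coloring G k V \<longleftrightarrow>
    (\<Union>i\<in>{1..k}. V i) = verts G \<and>
    disjoint_family_on V {1..k} \<and>
    (\<forall>i\<in>{1..k}. V i \<noteq> {} \<and> independent_set G (V i)) \<and>
    (\<forall>i\<in>{1..k}. \<forall>v\<in>V i. \<forall>j\<in>{1..<i}. \<exists>u\<in>V j. v \<rightarrow>\<^bsub>G\<^esub> u)"

text \<open>
  For a finite graph the maximum exists: the greedy algorithm yields a Grundy coloring, and the
  number of classes is at most the number of vertices.
\<close>

definition grundy_number :: "('a, 'b) pre_digraph \<Rightarrow> nat" where
  "grundy_number G = (GREATEST k. \<exists>V. grundy_coloring G k V)"

definition vertex_ordering :: "('a, 'b) pre_digraph \<Rightarrow> 'a list \<Rightarrow> bool" where
  "vertex_ordering G xs \<longleftrightarrow> distinct xs \<and> set xs = verts G"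

definition coloring_number :: "('a, 'b) pre_digraph \<Rightarrow> nat" where
  "coloring_number G =
    (LEAST k. \<exists>xs. vertex_ordering G xs \<and>
      (\<forall>i < length xs. card {u \<in> set (take i xs). xs ! i \<rightarrow>\<^bsub>G\<^esub> u} < k))"

end

theory Submission
  imports Defs
begin

text \<open>
  In a \<open>{P\<^sub>4, C\<^sub>4}\<close>-free graph the closed neighbourhoods \<open>N[u]\<close> and \<open>N[v]\<close> of adjacent
  vertices are comparable: if \<open>x \<in> N[u] - N[v]\<close> and \<open>y \<in> N[v] - N[u]\<close>, then \<open>x, u, v, y\<close> induce
  \<open>C\<^sub>4\<close> or \<open>P\<^sub>4\<close>, according to whether \<open>x\<close> and \<open>y\<close> are adjacent (\<open>adj_closed_nbhd_nested\<close>).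
  The vertices thus form a forest of sorts. Call \<open>u \<in> N[v]\<close> an ancestor of \<open>v\<close> if
  \<open>N[v] \<subseteq> N[u]\<close>. The ancestors of a vertex form a clique, the relation is transitive, and of two
  adjacent vertices one is an ancestor of the other.

  Upper bound for \<open>\<Gamma>\<close>. Start at a vertex \<open>x\<close> in the last class of a Grundy coloring and go through
  the classes downwards. If the ancestors of \<open>x\<close> miss the next class, then \<open>x\<close> has a neighbour
  there that is not its ancestor, so it is a descendant. Moving to that neighbour only enlarges the
  ancestor set. At the end one ancestor set meets all \<open>k\<close> classes (\<open>grundy_coloring_ancestors\<close>), so
  there is a clique of size \<open>k\<close>. The last vertex of this clique in any vertex ordering is preceded by
  at least \<open>k - 1\<close> of its neighbours, whence \<open>\<Gamma> \<le> col\<close>.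

  Upper bound for \<open>col\<close>. Order the vertices by decreasing size of the closed neighbourhood. The
  neighbours preceding a vertex are then ancestors of it, and their numbers of preceding neighbours
  are \<open>0, 1, 2, \<dots>\<close>. Hence the classes of equal number of preceding neighbours form a Grundy
  coloring, and the same ordering shows that \<open>col\<close> is at most the number of its classes
  (\<open>exists_grundy_degenerate_ordering\<close>).

  Since being \<open>{P\<^sub>4, C\<^sub>4}\<close>-free is hereditary, this gives one direction. For the other it suffices
  that both forbidden graphs violate the equation: \<open>col(P\<^sub>4) \<le> 2 < 3 \<le> \<Gamma>(P\<^sub>4)\<close> and
  \<open>\<Gamma>(C\<^sub>4) = 2 < 3 \<le> col(C\<^sub>4)\<close>.
\<close>

section \<open>Graph isomorphism to a concrete graph\<close>

lemma induced_subgraph_trans: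
  assumes "induced_subgraph K H" "induced_subgraph H G"
  shows "induced_subgraph K G"
  using assms unfolding induced_subgraph_def subgraph_def compatible_def by auto

lemma (in graph) graph_induced:
  assumes "induced_subgraph H G"
  shows "graph H"
proof -
  interpret H: digraph H using assms by (rule digraphI_induced)
  show ?thesis
    using induced_graph_imp_symmetric[OF sym_arcs assms] by (rule H.graphI)
qed

lemma (in graph) adj_sym: "u \<rightarrow> v \<Longrightarrow> v \<rightarrow> u"
  by (rule arcs_ends_symmetric[OF sym_arcs])

lemma adj_induce_subgraph_iff:
  "u \<rightarrow>\<^bsub>G \<restriction> S\<^esub> v \<longleftrightarrow> u \<rightarrow>\<^bsub>G\<^esub> v \<and> u \<in> S \<and> v \<in> S"
  by (auto simp: arcs_ends_conv)

text \<open>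
  Without parallel arcs an arc is determined by its ends, so an isomorphism amounts to a bijection
  of the vertices that respects adjacency. The bijection goes from the concrete graph into \<open>G\<close>
  because then it simply names the vertices of \<open>G\<close>.
\<close>

lemma (in nomulti_digraph) digraph_iso_with_proj_iff:
  assumes P: "parcs P \<subseteq> pverts P \<times> pverts P"
  shows "digraph_iso G (with_proj P) \<longleftrightarrow>
    (\<exists>g. bij_betw g (pverts P) (verts G) \<and>
      (\<forall>i\<in>pverts P. \<forall>j\<in>pverts P. (i, j) \<in> parcs P \<longleftrightarrow> g i \<rightarrow> g j))"
proof
  assume "digraph_iso G (with_proj P)"
  then obtain h where h: "digraph_isomorphism h" and PG: "with_proj P = app_iso h G"
    by (auto simp: digraph_iso_def)
  let ?f = "iso_verts h"
  have inj: "inj_on ?f (verts G)"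
    using h by (rule digraph_isomorphism_inj_on_verts)
  have pv: "pverts P = ?f ` verts G"
    using arg_cong[OF PG, of verts] by simp
  have pa: "parcs P = (\<lambda>(u, v). (?f u, ?f v)) ` arcs_ends G"
    using arg_cong[OF PG, of arcs_ends] arcs_ends_app_iso_eq[OF h] by simp
  have adj: "(?f u, ?f v) \<in> parcs P \<longleftrightarrow> u \<rightarrow> v" if "u \<in> verts G" "v \<in> verts G" for u v
  proof
    assume "(?f u, ?f v) \<in> parcs P"
    then obtain u' v' where "u' \<rightarrow> v'" "?f u = ?f u'" "?f v = ?f v'"
      unfolding pa by auto
    then show "u \<rightarrow> v"
      using that inj adj_in_verts[of u' v'] by (metis inj_onD)
  qed (auto simp: pa)
  have "bij_betw (the_inv_into (verts G) ?f) (pverts P) (verts G)"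
    unfolding pv using inj by (intro bij_betw_the_inv_into bij_betw_imageI) auto
  moreover have "(i, j) \<in> parcs P \<longleftrightarrow>
      the_inv_into (verts G) ?f i \<rightarrow> the_inv_into (verts G) ?f j"
    if "i \<in> pverts P" "j \<in> pverts P" for i j
    using that adj unfolding pv by (auto simp: the_inv_into_f_f[OF inj])
  ultimately show "\<exists>g. bij_betw g (pverts P) (verts G) \<and>
      (\<forall>i\<in>pverts P. \<forall>j\<in>pverts P. (i, j) \<in> parcs P \<longleftrightarrow> g i \<rightarrow> g j)"
    by blast
next
  assume "\<exists>g. bij_betw g (pverts P) (verts G) \<and>
      (\<forall>i\<in>pverts P. \<forall>j\<in>pverts P. (i, j) \<in> parcs P \<longleftrightarrow> g i \<rightarrow> g j)"
  then obtain g where g: "bij_betw g (pverts P) (verts G)"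
    and adj: "\<And>i j. i \<in> pverts P \<Longrightarrow> j \<in> pverts P \<Longrightarrow> (i, j) \<in> parcs P \<longleftrightarrow> g i \<rightarrow> g j"
    by blast
  define f where "f = the_inv_into (pverts P) g"
  have f: "bij_betw f (verts G) (pverts P)"
    unfolding f_def using g by (rule bij_betw_the_inv_into)
  have gf: "g (f v) = v" if "v \<in> verts G" for v
    unfolding f_def using g that by (metis bij_betw_def f_the_inv_into_f)
  have fv: "f v \<in> pverts P" if "v \<in> verts G" for v
    using f that by (auto simp: bij_betw_def)
  have inj: "inj_on f (verts G)"
    using f by (simp add: bij_betw_def)
  define h where "h = \<lparr>iso_verts = f, iso_arcs = (\<lambda>e. (f (tail G e), f (head G e))),
    iso_head = snd, iso_tail = fst\<rparr>"
  have "inj_on (\<lambda>e. (f (tail G e), f (head G e))) (arcs G)"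
  proof (rule inj_onI)
    fix e e' assume e: "e \<in> arcs G" "e' \<in> arcs G"
      and eq: "(f (tail G e), f (head G e)) = (f (tail G e'), f (head G e'))"
    then have "tail G e = tail G e'" "head G e = head G e'"
      using inj_onD[OF inj] by auto
    then show "e = e'"
      using e no_multi_arcs by (simp add: arc_to_ends_def)
  qed
  then have "digraph_isomorphism h"
    using inj wf_digraph by (simp add: digraph_isomorphism_def h_def)
  moreover have "parcs P = (\<lambda>e. (f (tail G e), f (head G e))) ` arcs G"
  proof (intro set_eqI iffI)
    fix p assume p: "p \<in> parcs P"
    obtain i j where ij: "p = (i, j)" by (cases p)
    with p P have mem: "i \<in> pverts P" "j \<in> pverts P" by auto
    then have "g i \<rightarrow> g j" using adj p ij by simp
    then obtain e where e: "e \<in> arcs G" "tail G e = g i" "head G e = g j"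
      by (rule reachableE)
    moreover have "f (g i) = i" "f (g j) = j"
      unfolding f_def using g mem by (auto simp: bij_betw_def the_inv_into_f_f)
    ultimately show "p \<in> (\<lambda>e. (f (tail G e), f (head G e))) ` arcs G"
      using ij by (auto intro!: image_eqI[of _ _ e])
  next
    fix p assume "p \<in> (\<lambda>e. (f (tail G e), f (head G e))) ` arcs G"
    then obtain e where e: "e \<in> arcs G" "p = (f (tail G e), f (head G e))" by blast
    then have "tail G e \<rightarrow> head G e" by (auto simp: arcs_ends_conv)
    then show "p \<in> parcs P"
      using e adj fv gf by simp
  qed
  then have "with_proj P = app_iso h G"
    using f by (simp add: with_proj_def app_iso_def h_def bij_betw_def)
  ultimately show "digraph_iso G (with_proj P)"
    unfolding digraph_iso_def by blast
qed

lemma below_4: "{0..<4} = {0, 1, 2, 3 :: nat}"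
  by auto

text \<open>
  A symmetric and irreflexive relation on four vertices is given by its values on the six pairs
  \<open>i < j\<close>.
\<close>

lemma (in graph) iso_four_vertices_iff:
  assumes P: "pverts P = {0..<4 :: nat}" "parcs P \<subseteq> {0..<4} \<times> {0..<4}"
    and sym: "\<And>i j. (i, j) \<in> parcs P \<Longrightarrow> (j, i) \<in> parcs P"
    and irrefl: "\<And>i. (i, i) \<notin> parcs P"
  shows "digraph_iso G (with_proj P) \<longleftrightarrow>
    (\<exists>a b c d. distinct [a, b, c, d] \<and> verts G = {a, b, c, d} \<and>
      (a \<rightarrow> b \<longleftrightarrow> (0, 1) \<in> parcs P) \<and> (a \<rightarrow> c \<longleftrightarrow> (0, 2) \<in> parcs P) \<and>
      (a \<rightarrow> d \<longleftrightarrow> (0, 3) \<in> parcs P) \<and> (b \<rightarrow> c \<longleftrightarrow> (1, 2) \<in> parcs P) \<and>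
      (b \<rightarrow> d \<longleftrightarrow> (1, 3) \<in> parcs P) \<and> (c \<rightarrow> d \<longleftrightarrow> (2, 3) \<in> parcs P))"
    (is "_ \<longleftrightarrow> (\<exists>a b c d. ?Q a b c d)")
proof -
  have "(\<exists>g. bij_betw g {0..<4} (verts G) \<and>
      (\<forall>i\<in>{0..<4}. \<forall>j\<in>{0..<4}. (i, j) \<in> parcs P \<longleftrightarrow> g i \<rightarrow> g j)) \<longleftrightarrow> (\<exists>a b c d. ?Q a b c d)"
    (is "(\<exists>g. ?bij g \<and> ?adj g) \<longleftrightarrow> _")
  proof
    assume "\<exists>g. ?bij g \<and> ?adj g"
    then obtain g where "?bij g" and adj: "?adj g" by blast
    then have "distinct [g 0, g 1, g 2, g 3]" "verts G = {g 0, g 1, g 2, g 3}"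
      unfolding below_4 bij_betw_def inj_on_def by auto
    with adj have "?Q (g 0) (g 1) (g 2) (g 3)"
      by simp
    then show "\<exists>a b c d. ?Q a b c d" by blast
  next
    assume "\<exists>a b c d. ?Q a b c d"
    then obtain a b c d where Q: "?Q a b c d" by blast
    let ?g = "(!) [a, b, c, d]"
    have nth: "?g 0 = a" "?g 1 = b" "?g 2 = c" "?g 3 = d" by simp_all
    have "?bij ?g"
      using Q unfolding below_4 bij_betw_def inj_on_def by auto
    moreover have "?adj ?g"
    proof -
      have symP: "(i, j) \<in> parcs P \<longleftrightarrow> (j, i) \<in> parcs P" for i j
        using sym by blast
      have symG: "u \<rightarrow> v \<longleftrightarrow> v \<rightarrow> u" for u v
        using adj_sym by blast
      have loops: "\<not> u \<rightarrow> u" for u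
        using adj_not_same by blast
      show ?thesis
        unfolding below_4 ball_simps nth
        using Q irrefl loops symG symP by (metis (no_types))
    qed
    ultimately show "\<exists>g. ?bij g \<and> ?adj g" by blast
  qed
  then show ?thesis
    using digraph_iso_with_proj_iff[of P] P by simp
qed

lemma (in graph) iso_path_4_iff:
  "digraph_iso G (with_proj (path_graph 4)) \<longleftrightarrow>
    (\<exists>a b c d. distinct [a, b, c, d] \<and> verts G = {a, b, c, d} \<and>
      a \<rightarrow> b \<and> b \<rightarrow> c \<and> c \<rightarrow> d \<and> \<not> a \<rightarrow> c \<and> \<not> b \<rightarrow> d \<and> \<not> a \<rightarrow> d)"
  by (subst iso_four_vertices_iff) (auto simp: path_graph_def)

lemma (in graph) iso_cycle_4_iff:
  "digraph_iso G (with_proj (cycle_graph 4)) \<longleftrightarrow>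
    (\<exists>a b c d. distinct [a, b, c, d] \<and> verts G = {a, b, c, d} \<and>
      a \<rightarrow> b \<and> b \<rightarrow> c \<and> c \<rightarrow> d \<and> \<not> a \<rightarrow> c \<and> \<not> b \<rightarrow> d \<and> a \<rightarrow> d)"
proof -
  have "i \<noteq> Suc i mod 4" for i :: nat
    by presburger
  then show ?thesis
    by (subst iso_four_vertices_iff) (auto simp: cycle_graph_def)
qed

section \<open>Nested neighbourhoods\<close>

definition closed_nbhd :: "('a, 'b) pre_digraph \<Rightarrow> 'a \<Rightarrow> 'a set" where
  "closed_nbhd G v = insert v {u. v \<rightarrow>\<^bsub>G\<^esub> u}"

lemma (in graph) closed_nbhd_sym: "u \<in> closed_nbhd G v \<Longrightarrow> v \<in> closed_nbhd G u"
  by (auto simp: closed_nbhd_def intro: adj_sym)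

text \<open>
  Witnesses \<open>x\<close> and \<open>y\<close> against the two inclusions extend the edge \<open>uv\<close> to a path \<open>x, u, v, y\<close>
  whose only possible chord is \<open>xy\<close>.
\<close>

lemma (in graph) adj_closed_nbhd_nested:
  assumes free: "induced_free {with_proj (path_graph 4), with_proj (cycle_graph 4)} G"
    and uv: "u \<rightarrow> v"
  shows "closed_nbhd G u \<subseteq> closed_nbhd G v \<or> closed_nbhd G v \<subseteq> closed_nbhd G u"
proof (rule ccontr)
  assume "\<not> ?thesis"
  then obtain x y where x: "x \<in> closed_nbhd G u" "x \<notin> closed_nbhd G v"
    and y: "y \<in> closed_nbhd G v" "y \<notin> closed_nbhd G u"
    by blast
  have adj: "x \<rightarrow> u" "v \<rightarrow> y" "\<not> x \<rightarrow> v" "\<not> u \<rightarrow> y" and ne: "distinct [x, u, v, y]"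
    using x y uv by (auto simp: closed_nbhd_def intro: adj_sym dest: adj_not_same)
  let ?S = "{x, u, v, y}"
  have "?S \<subseteq> verts G"
    using adj by (auto dest: adj_in_verts)
  then have ind: "induced_subgraph (G \<restriction> ?S) G"
    by (rule induced_induce)
  then interpret H: graph "G \<restriction> ?S"
    by (rule graph_induced)
  have "digraph_iso (G \<restriction> ?S) (with_proj (path_graph 4)) \<or>
      digraph_iso (G \<restriction> ?S) (with_proj (cycle_graph 4))"
  proof (cases "x \<rightarrow> y")
    case True
    then have "digraph_iso (G \<restriction> ?S) (with_proj (cycle_graph 4))"
      unfolding H.iso_cycle_4_iff adj_induce_subgraph_iff
      using adj ne uv by (intro exI[of _ x] exI[of _ u] exI[of _ v] exI[of _ y]) simp
    then show ?thesis ..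
  next
    case False
    then have "digraph_iso (G \<restriction> ?S) (with_proj (path_graph 4))"
      unfolding H.iso_path_4_iff adj_induce_subgraph_iff
      using adj ne uv by (intro exI[of _ x] exI[of _ u] exI[of _ v] exI[of _ y]) simp
    then show ?thesis ..
  qed
  with free ind show False
    unfolding induced_free_def by blast
qed

section \<open>Bounds for the coloring number and the Grundy number\<close>

definition degenerate_ordering :: "('a, 'b) pre_digraph \<Rightarrow> nat \<Rightarrow> 'a list \<Rightarrow> bool" where
  "degenerate_ordering G k xs \<longleftrightarrow> vertex_ordering G xs \<and>
    (\<forall>i < length xs. card {u \<in> set (take i xs). xs ! i \<rightarrow>\<^bsub>G\<^esub> u} < k)"

lemma coloring_number_altdef: "coloring_number G = (LEAST k. \<exists>xs. degenerate_ordering G k xs)"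
  by (simp add: coloring_number_def degenerate_ordering_def)

lemma coloring_number_le: "degenerate_ordering G k xs \<Longrightarrow> coloring_number G \<le> k"
  unfolding coloring_number_altdef by (rule Least_le) blast

lemma (in fin_digraph) degenerate_ordering_coloring_number:
  "\<exists>xs. degenerate_ordering G (coloring_number G) xs"
  unfolding coloring_number_altdef
proof (rule LeastI_ex)
  obtain xs where xs: "set xs = verts G" "distinct xs"
    using finite_distinct_list[OF finite_verts] by blast
  have "card {u \<in> set (take i xs). xs ! i \<rightarrow> u} < Suc (length xs)" for i
  proof -
    have "card {u \<in> set (take i xs). xs ! i \<rightarrow> u} \<le> card (set (take i xs))"
      by (intro card_mono) auto
    also have "\<dots> \<le> length xs"
      using card_length[of "take i xs"] by simp
    finally show ?thesis by simp
  qed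
  then have "degenerate_ordering G (Suc (length xs)) xs"
    using xs by (simp add: degenerate_ordering_def vertex_ordering_def)
  then show "\<exists>k xs. degenerate_ordering G k xs" by blast
qed

text \<open>
  In any ordering, the vertex of \<open>W\<close> that comes last is preceded by all its neighbours in \<open>W\<close>.
\<close>

lemma (in fin_digraph) min_degree_less_coloring_number:
  assumes W: "W \<subseteq> verts G" "W \<noteq> {}"
    and deg: "\<And>w. w \<in> W \<Longrightarrow> d \<le> card {u \<in> W - {w}. w \<rightarrow> u}"
  shows "d < coloring_number G"
proof -
  obtain xs where xs: "degenerate_ordering G (coloring_number G) xs"
    using degenerate_ordering_coloring_number by blast
  then have set: "set xs = verts G"
    by (simp add: degenerate_ordering_def vertex_ordering_def)
  define I where "I = {i. i < length xs \<and> xs ! i \<in> W}"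
  have "finite I" by (simp add: I_def)
  moreover have "I \<noteq> {}"
    using W unfolding set[symmetric] I_def
    by (metis (mono_tags, lifting) empty_iff ex_in_conv in_set_conv_nth mem_Collect_eq subsetD)
  ultimately have m: "Max I \<in> I" and max: "\<And>i. i \<in> I \<Longrightarrow> i \<le> Max I"
    by auto
  let ?w = "xs ! Max I"
  have len: "Max I < length xs" and w: "?w \<in> W"
    using m by (auto simp: I_def)
  have "{u \<in> W - {?w}. ?w \<rightarrow> u} \<subseteq> {u \<in> set (take (Max I) xs). ?w \<rightarrow> u}"
  proof safe
    fix u assume u: "u \<in> W" "u \<noteq> ?w"
    then obtain i where i: "i < length xs" "u = xs ! i"
      using W unfolding set[symmetric] by (metis in_set_conv_nth subsetD)
    then have "i \<in> I" using u by (simp add: I_def)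
    then have "i < Max I" using max[of i] u i by (cases "i = Max I") auto
    then show "u \<in> set (take (Max I) xs)"
      using i len by (auto simp: in_set_conv_nth intro!: exI[of _ i])
  qed
  then have "card {u \<in> W - {?w}. ?w \<rightarrow> u} \<le> card {u \<in> set (take (Max I) xs). ?w \<rightarrow> u}"
    by (intro card_mono) auto
  with deg[OF w] have "d \<le> card {u \<in> set (take (Max I) xs). ?w \<rightarrow> u}" by simp
  also have "\<dots> < coloring_number G"
    using xs len by (simp add: degenerate_ordering_def)
  finally show ?thesis .
qed

lemma (in fin_digraph) clique_le_coloring_number:
  assumes K: "K \<subseteq> verts G" "K \<noteq> {}"
    and clique: "\<And>u v. u \<in> K \<Longrightarrow> v \<in> K \<Longrightarrow> v \<in> closed_nbhd G u"
  shows "card K \<le> coloring_number G"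
proof -
  have "card K - 1 < coloring_number G"
  proof (rule min_degree_less_coloring_number[OF K])
    fix w assume w: "w \<in> K"
    have "{u \<in> K - {w}. w \<rightarrow> u} = K - {w}"
      using clique w by (auto simp: closed_nbhd_def)
    then show "card K - 1 \<le> card {u \<in> K - {w}. w \<rightarrow> u}"
      using w by simp
  qed
  then show ?thesis by simp
qed

text \<open>
  The maximum in the definition of the Grundy number is only meaningful if the numbers of classes
  are bounded.
\<close>

lemma (in fin_digraph) grundy_coloring_le_card_verts:
  assumes "grundy_coloring G k V"
  shows "k \<le> card (verts G)"
proof -
  have un: "(\<Union>i\<in>{1..k}. V i) = verts G" and disj: "disjoint_family_on V {1..k}"
    and ne: "\<And>i. i \<in> {1..k} \<Longrightarrow> V i \<noteq> {}"
    using assms by (auto simp: grundy_coloring_def)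
  have fin: "finite (V i)" if "i \<in> {1..k}" for i
    using un that by (intro finite_subset[OF _ finite_verts]) auto
  have "k = (\<Sum>i\<in>{1..k}. 1)" by simp
  also have "\<dots> \<le> (\<Sum>i\<in>{1..k}. card (V i))"
    using fin ne by (intro sum_mono) (simp add: Suc_le_eq card_gt_0_iff)
  also have "\<dots> = card (\<Union>i\<in>{1..k}. V i)"
    using fin disj by (intro card_UN_disjoint[symmetric]) (auto simp: disjoint_family_on_def)
  finally show ?thesis using un by simp
qed

lemma (in fin_digraph) grundy_coloring_le_grundy_number:
  assumes "grundy_coloring G k V"
  shows "k \<le> grundy_number G"
  unfolding grundy_number_def
  by (rule Greatest_le_nat[where b = "card (verts G)"])
    (use assms grundy_coloring_le_card_verts in auto)

section \<open>Graphs with nested neighbourhoods\<close>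

locale nested_graph = graph +
  assumes nested: "u \<rightarrow> v \<Longrightarrow>
    closed_nbhd G u \<subseteq> closed_nbhd G v \<or> closed_nbhd G v \<subseteq> closed_nbhd G u"
begin

text \<open>
  Vertices with equal closed neighbourhoods are ancestors of each other, so this is only a preorder.
\<close>

definition ancestors :: "'a \<Rightarrow> 'a set" where
  "ancestors v = {u \<in> closed_nbhd G v. closed_nbhd G v \<subseteq> closed_nbhd G u}"

lemma self_in_ancestors: "v \<in> ancestors v"
  by (auto simp: ancestors_def closed_nbhd_def)

lemma ancestors_clique: "u \<in> ancestors v \<Longrightarrow> w \<in> ancestors v \<Longrightarrow> w \<in> closed_nbhd G u"
  by (auto simp: ancestors_def)

lemma ancestors_trans: "u \<in> ancestors v \<Longrightarrow> v \<in> ancestors w \<Longrightarrow> u \<in> ancestors w"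
  unfolding ancestors_def using closed_nbhd_sym by blast

lemma adj_ancestors: "u \<rightarrow> v \<Longrightarrow> u \<in> ancestors v \<or> v \<in> ancestors u"
  using nested[of u v] adj_sym[of u v] by (auto simp: ancestors_def closed_nbhd_def)

text \<open>
  Downward induction on the lowest class \<open>j\<close> that has been reached. The vertex \<open>x\<close> is kept in
  some class \<open>c \<ge> j\<close>, so that it has a neighbour in every class below \<open>j\<close>. If \<open>x\<close> has no
  ancestor in the next class, its neighbour there is a descendant of \<open>x\<close>, inherits all ancestors
  of \<open>x\<close> and is an ancestor of itself.
\<close>

lemma grundy_coloring_ancestors:
  assumes col: "grundy_coloring G k V" and k: "1 \<le> k"
  shows "\<exists>x. \<forall>i\<in>{1..k}. V i \<inter> ancestors x \<noteq> {}"
proof -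
  have ne: "V i \<noteq> {}" if "i \<in> {1..k}" for i
    using col that by (auto simp: grundy_coloring_def)
  have nbr: "\<exists>u\<in>V j. v \<rightarrow> u" if "i \<in> {1..k}" "v \<in> V i" "j \<in> {1..<i}" for i j v
    using col that unfolding grundy_coloring_def by blast
  have "\<exists>c\<in>{1..k}. \<exists>x\<in>V c. \<forall>i\<in>{1..k}. V i \<inter> ancestors x \<noteq> {}"
    using k
  proof (induction rule: inc_induct)
    case base
    obtain v where "v \<in> V k" using ne[of k] k by auto
    then show ?case using self_in_ancestors by auto
  next
    case (step j)
    then obtain c x where c: "c \<in> {Suc j..k}" and x: "x \<in> V c"
      and anc: "\<And>i. i \<in> {Suc j..k} \<Longrightarrow> V i \<inter> ancestors x \<noteq> {}"
      by blast
    have split: "i = j \<or> i \<in> {Suc j..k}" if "i \<in> {j..k}" for i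
      using that by auto
    show ?case
    proof (cases "V j \<inter> ancestors x = {}")
      case False
      then have "V i \<inter> ancestors x \<noteq> {}" if "i \<in> {j..k}" for i
        using split[OF that] anc by blast
      then show ?thesis using c x by (intro bexI[of _ c] bexI[of _ x]) auto
    next
      case True
      obtain u where u: "u \<in> V j" "x \<rightarrow> u"
        using nbr[of c x j] c x step.hyps by auto
      with True have "x \<in> ancestors u"
        using adj_ancestors by blast
      then have "ancestors x \<subseteq> ancestors u"
        using ancestors_trans by blast
      then have "V i \<inter> ancestors u \<noteq> {}" if "i \<in> {j..k}" for i
        using split[OF that] anc[of i] u(1) self_in_ancestors[of u] by blast
      then show ?thesis using u(1) step.hyps by (intro bexI[of _ j] bexI[of _ u]) auto
    qed
  qed
  then show ?thesis by blast
qed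

text \<open>One ancestor of a common vertex from each class makes a clique of size \<open>k\<close>.\<close>

lemma grundy_coloring_le_coloring_number:
  assumes col: "grundy_coloring G k V" and ne: "verts G \<noteq> {}"
  shows "k \<le> coloring_number G"
proof -
  have un: "(\<Union>i\<in>{1..k}. V i) = verts G" and disj: "disjoint_family_on V {1..k}"
    using col by (auto simp: grundy_coloring_def)
  then have k: "1 \<le> k" using ne by (cases k) auto
  obtain x where x: "\<And>i. i \<in> {1..k} \<Longrightarrow> V i \<inter> ancestors x \<noteq> {}"
    using grundy_coloring_ancestors[OF col k] by blast
  then have "\<forall>i\<in>{1..k}. \<exists>u. u \<in> V i \<inter> ancestors x" by blast
  then obtain f where f: "\<And>i. i \<in> {1..k} \<Longrightarrow> f i \<in> V i \<inter> ancestors x"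
    using bchoice[of "{1..k}" "\<lambda>i u. u \<in> V i \<inter> ancestors x"] by blast
  have "inj_on f {1..k}"
    using f disj unfolding inj_on_def disjoint_family_on_def by (metis IntD1 IntI empty_iff)
  then have "k = card (f ` {1..k})"
    by (simp add: card_image)
  also have "\<dots> \<le> coloring_number G"
  proof (rule clique_le_coloring_number)
    show "f ` {1..k} \<subseteq> verts G" using f un by blast
    show "f ` {1..k} \<noteq> {}" using k by auto
    show "v \<in> closed_nbhd G u" if "u \<in> f ` {1..k}" "v \<in> f ` {1..k}" for u v
      using that f ancestors_clique by blast
  qed
  finally show ?thesis .
qed

text \<open>
  A single ordering, by decreasing size of the closed neighbourhood, serves both purposes. The
  neighbours preceding a vertex \<open>v\<close> are ancestors of \<open>v\<close> and hence a clique; the first of them is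
  preceded by none of its neighbours, the next by exactly one, and so on up to \<open>v\<close>. So
  the number of preceding neighbours is a proper coloring in which \<open>v\<close> sees all smaller colors.
\<close>

lemma exists_grundy_degenerate_ordering:
  assumes ne: "verts G \<noteq> {}"
  shows "\<exists>k V xs. grundy_coloring G k V \<and> degenerate_ordering G k xs"
proof -
  obtain ys where ys: "set ys = verts G" "distinct ys"
    using finite_distinct_list[OF finite_verts] by blast
  \<comment> \<open>The sign turns the ascending sort into a descending one.\<close>
  define key where "key v = - int (card (closed_nbhd G v))" for v
  define xs where "xs = sort_key key ys"
  define n where "n = length xs"
  have set: "set xs = verts G" and dist: "distinct xs"
    using ys by (auto simp: xs_def)
  have sorted: "sorted (map key xs)"
    by (simp add: xs_def)
  have fin: "finite (closed_nbhd G v)" for v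
    by (rule finite_subset[of _ "insert v (verts G)"])
      (auto simp: closed_nbhd_def dest: adj_in_verts)
  have anc: "xs ! i \<in> ancestors (xs ! j)" if "i < j" "j < n" "xs ! j \<rightarrow> xs ! i" for i j
  proof -
    have "key (xs ! i) \<le> key (xs ! j)"
      using sorted_nth_mono[OF sorted, of i j] that by (simp add: n_def)
    then have "card (closed_nbhd G (xs ! j)) \<le> card (closed_nbhd G (xs ! i))"
      by (simp add: key_def)
    then have "closed_nbhd G (xs ! j) \<subseteq> closed_nbhd G (xs ! i)"
      using nested[OF that(3)] card_seteq[OF fin] by blast
    then show ?thesis
      using that(3) by (simp add: ancestors_def closed_nbhd_def)
  qed
  \<comment> \<open>Vertices are handled by their positions in the ordering: \<open>Q j\<close> are the positions of the
    preceding neighbours of the vertex at position \<open>j\<close>.\<close>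
  define Q where "Q j = {i. i < j \<and> xs ! j \<rightarrow> xs ! i}" for j
  define depth where "depth j = card (Q j)" for j
  have finQ: "finite (Q j)" for j by (simp add: Q_def)
  have Q_I: "i \<in> Q j" if "i < j" "j < n" "xs ! i \<in> closed_nbhd G (xs ! j)" for i j
  proof -
    have "xs ! i \<noteq> xs ! j"
      using dist that by (simp add: nth_eq_iff_index_eq n_def)
    then show ?thesis using that by (auto simp: Q_def closed_nbhd_def)
  qed
  have depth_less: "depth i < depth j" if "i \<in> Q j" "j < n" for i j
  proof -
    have "Q i \<subseteq> Q j"
    proof
      fix l assume l: "l \<in> Q i"
      have "xs ! l \<in> ancestors (xs ! i)" "xs ! i \<in> ancestors (xs ! j)"
        using l that anc by (auto simp: Q_def)
      then have "xs ! l \<in> ancestors (xs ! j)" by (rule ancestors_trans)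
      then show "l \<in> Q j"
        using l that by (intro Q_I) (auto simp: Q_def ancestors_def)
    qed
    moreover have "i \<notin> Q i" by (simp add: Q_def)
    ultimately have "Q i \<subset> Q j" using that by blast
    then show ?thesis unfolding depth_def by (intro psubset_card_mono finQ)
  qed
  \<comment> \<open>The depths of the preceding neighbours are pairwise distinct and less than \<open>depth j\<close>, and there
    are \<open>depth j\<close> of them, so every smaller depth occurs.\<close>
  have depth_image: "depth ` Q j = {..<depth j}" if j: "j < n" for j
  proof (rule card_subset_eq)
    show "depth ` Q j \<subseteq> {..<depth j}" using depth_less j by auto
    have less: "depth i < depth i'" if "i \<in> Q j" "i' \<in> Q j" "i < i'" for i i'
    proof (rule depth_less)
      have "xs ! i \<in> ancestors (xs ! j)" "xs ! i' \<in> ancestors (xs ! j)"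
        using that anc j by (auto simp: Q_def)
      then show "i \<in> Q i'"
        using that j ancestors_clique by (intro Q_I) (auto simp: Q_def)
      show "i' < n" using that j by (simp add: Q_def)
    qed
    have "inj_on depth (Q j)"
      by (rule inj_onI) (metis less less_irrefl linorder_neqE_nat)
    then show "card (depth ` Q j) = card {..<depth j}"
      by (simp add: card_image depth_def[of j])
  qed simp
  define k where "k = Suc (Max (depth ` {..<n}))"
  have n: "0 < n" using ne set by (auto simp: n_def)
  have less_k: "depth j < k" if "j < n" for j
    using that by (simp add: k_def less_Suc_eq_le)
  have "Max (depth ` {..<n}) \<in> depth ` {..<n}"
    using n by (intro Max_in) auto
  then obtain top where top: "top < n" "Suc (depth top) = k"
    by (auto simp: k_def)
  \<comment> \<open>Classes are numbered from 1 and depths from 0.\<close>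
  define V where "V c = (\<lambda>j. xs ! j) ` {j. j < n \<and> Suc (depth j) = c}" for c
  have grundy: "\<exists>u\<in>V c. xs ! j \<rightarrow> u" if "j < n" "c \<in> {1..<Suc (depth j)}" for c j
  proof -
    have "c - 1 \<in> depth ` Q j" using that by (auto simp: depth_image)
    then obtain i where i: "i \<in> Q j" "depth i = c - 1" by auto
    then have "xs ! i \<in> V c" using that by (auto simp: V_def Q_def)
    then show ?thesis using i by (auto simp: Q_def)
  qed
  have "grundy_coloring G k V"
    unfolding grundy_coloring_def
  proof (intro conjI ballI)
    have "xs ! j \<in> (\<Union>i\<in>{1..k}. V i)" if "j < n" for j
      using that less_k[OF that] by (auto simp: V_def Suc_le_eq)
    then show "(\<Union>i\<in>{1..k}. V i) = verts G"
      unfolding set[symmetric] by (auto simp: V_def n_def in_set_conv_nth)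
    show "disjoint_family_on V {1..k}"
      using dist by (auto simp: disjoint_family_on_def V_def n_def nth_eq_iff_index_eq)
  next
    fix c assume c: "c \<in> {1..k}"
    show "V c \<noteq> {}"
    proof (cases "c = k")
      case True
      then show ?thesis using top by (auto simp: V_def)
    next
      case False
      then show ?thesis using grundy[OF top(1), of c] c top(2) by auto
    qed
    have indep: "\<not> xs ! j \<rightarrow> xs ! i" if "i < j" "j < n" "depth i = depth j" for i j
      using depth_less[of i j] that by (auto simp: Q_def)
    have "\<not> xs ! i \<rightarrow> xs ! j" if "i < n" "j < n" "depth i = depth j" for i j
      using indep[of i j] indep[of j i] that adj_sym adj_not_same
      by (metis linorder_neqE_nat)
    then show "independent_set G (V c)"
      unfolding independent_set_def set[symmetric] by (auto simp: V_def n_def)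
    fix v j assume "v \<in> V c" "j \<in> {1..<c}"
    then show "\<exists>u\<in>V j. v \<rightarrow> u"
      using grundy by (auto simp: V_def)
  qed
  moreover have "degenerate_ordering G k xs"
    unfolding degenerate_ordering_def vertex_ordering_def
  proof (intro conjI allI impI dist set)
    fix j assume j: "j < length xs"
    have "{u \<in> set (take j xs). xs ! j \<rightarrow> u} \<subseteq> (\<lambda>i. xs ! i) ` Q j"
      using j by (auto simp: Q_def in_set_conv_nth)
    then have "card {u \<in> set (take j xs). xs ! j \<rightarrow> u} \<le> depth j"
      unfolding depth_def by (rule surj_card_le[OF finQ])
    also have "\<dots> < k" using less_k j by (simp add: n_def)
    finally show "card {u \<in> set (take j xs). xs ! j \<rightarrow> u} < k" .
  qed
  ultimately show ?thesis by blast
qed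

text \<open>
  The \<open>k\<close> of the preceding lemma satisfies \<open>col \<le> k\<close>, while every Grundy coloring, also the one
  with \<open>k\<close> classes, has at most \<open>col\<close> classes.
\<close>

theorem grundy_number_eq_coloring_number:
  assumes ne: "verts G \<noteq> {}"
  shows "grundy_number G = coloring_number G"
proof -
  obtain k V xs where V: "grundy_coloring G k V" and xs: "degenerate_ordering G k xs"
    using exists_grundy_degenerate_ordering[OF ne] by blast
  have "coloring_number G \<le> k" using xs by (rule coloring_number_le)
  moreover have bound: "l \<le> coloring_number G" if "\<exists>W. grundy_coloring G l W" for l
    using that grundy_coloring_le_coloring_number ne by blast
  ultimately have "k = coloring_number G" using V by (simp add: bound eq_iff exI)
  then show ?thesis
    unfolding grundy_number_def using V bound by (intro Greatest_equality) auto
qed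

end

section \<open>The path and the cycle on four vertices\<close>

text \<open>
  For the path \<open>a, b, c, d\<close> the classes \<open>{a, d}, {b}, {c}\<close> form a Grundy coloring, whereas along
  the path each vertex is preceded by at most one neighbour.
\<close>

lemma (in graph) grundy_number_neq_path_4:
  assumes "digraph_iso G (with_proj (path_graph 4))"
  shows "grundy_number G \<noteq> coloring_number G"
proof -
  obtain a b c d where ne: "distinct [a, b, c, d]" and V: "verts G = {a, b, c, d}"
    and adj: "a \<rightarrow> b" "b \<rightarrow> c" "c \<rightarrow> d" "\<not> a \<rightarrow> c" "\<not> b \<rightarrow> d" "\<not> a \<rightarrow> d"
    using assms unfolding iso_path_4_iff by blast
  have adj': "b \<rightarrow> a" "c \<rightarrow> b" "d \<rightarrow> c" "\<not> c \<rightarrow> a" "\<not> d \<rightarrow> b" "\<not> d \<rightarrow> a"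
    using adj adj_sym by blast+
  have loop: "\<not> u \<rightarrow> u" for u using adj_not_same by blast
  define W where "W i = (if i = 1 then {a, d} else if i = 2 then {b} else {c})" for i :: nat
  have 3: "{1..3} = {1, 2, 3 :: nat}" by auto
  have "grundy_coloring G 3 W"
    unfolding grundy_coloring_def 3 disjoint_family_on_def independent_set_def
    using ne V adj adj' loop
    by (auto simp: W_def Ball_def less_Suc_eq numeral_3_eq_3 numeral_2_eq_2)
  then have "3 \<le> grundy_number G" by (rule grundy_coloring_le_grundy_number)
  moreover have "degenerate_ordering G 2 [a, b, c, d]"
  proof -
    have "{u. u = a \<and> b \<rightarrow> u} = {a}" "{u. (u = a \<or> u = b) \<and> c \<rightarrow> u} = {b}"
      "{u. (u = a \<or> u = b \<or> u = c) \<and> d \<rightarrow> u} = {c}"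
      using adj adj' by auto
    then show ?thesis
      using ne V by (auto simp: degenerate_ordering_def vertex_ordering_def less_Suc_eq)
  qed
  then have "coloring_number G \<le> 2" by (rule coloring_number_le)
  ultimately show ?thesis by simp
qed

text \<open>
  Two neighbours of a vertex of the cycle in different classes would be opposite vertices, which have
  the same neighbours; this excludes a third class. On the other hand, all degrees are 2, which
  forces \<open>col > 2\<close>.
\<close>

lemma (in graph) grundy_number_neq_cycle_4:
  assumes "digraph_iso G (with_proj (cycle_graph 4))"
  shows "grundy_number G \<noteq> coloring_number G"
proof -
  obtain a b c d where ne: "distinct [a, b, c, d]" and V: "verts G = {a, b, c, d}"
    and adj: "a \<rightarrow> b" "b \<rightarrow> c" "c \<rightarrow> d" "\<not> a \<rightarrow> c" "\<not> b \<rightarrow> d" "a \<rightarrow> d"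
    using assms unfolding iso_cycle_4_iff by blast
  have adj': "b \<rightarrow> a" "c \<rightarrow> b" "d \<rightarrow> c" "\<not> c \<rightarrow> a" "\<not> d \<rightarrow> b" "d \<rightarrow> a"
    using adj adj_sym by blast+
  have loop: "\<not> u \<rightarrow> u" for u using adj_not_same by blast
  define W where "W i = (if i = 1 then {a, c} else {b, d})" for i :: nat
  have 2: "{1..2} = {1, 2 :: nat}" by auto
  have W: "grundy_coloring G 2 W"
    unfolding grundy_coloring_def 2 disjoint_family_on_def independent_set_def
    using ne V adj adj' loop
    by (auto simp: W_def Ball_def less_Suc_eq numeral_2_eq_2)
  have le2: "k \<le> 2" if ex: "\<exists>U. grundy_coloring G k U" for k
  proof (rule ccontr)
    assume "\<not> k \<le> 2"
    then have k: "3 \<le> k" by simp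
    obtain U where U: "grundy_coloring G k U" using ex by blast
    have ind: "\<not> u \<rightarrow> v" if "u \<in> U i" "v \<in> U i" "i \<in> {1..k}" for u v i
      using U that unfolding grundy_coloring_def independent_set_def by blast
    have nbr: "\<exists>u\<in>U j. v \<rightarrow> u" if "i \<in> {1..k}" "v \<in> U i" "j \<in> {1..<i}" for i j v
      using U that unfolding grundy_coloring_def by blast
    have "U 3 \<noteq> {}" using U k unfolding grundy_coloring_def by auto
    then obtain v where v: "v \<in> U 3" by blast
    obtain p where p: "p \<in> U 1" "v \<rightarrow> p" using nbr[of 3 v 1] v k by auto
    obtain q where q: "q \<in> U 2" "v \<rightarrow> q" using nbr[of 3 v 2] v k by auto
    obtain r where r: "r \<in> U 1" "q \<rightarrow> r" using nbr[of 2 q 1] q k by auto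
    \<comment> \<open>On the cycle, \<open>p\<close> and \<open>q\<close> are the two neighbours of \<open>v\<close>, and \<open>r \<noteq> v\<close> is the vertex
      opposite to \<open>v\<close>. So \<open>r\<close> is adjacent to \<open>p\<close>, although both lie in the first class.\<close>
    have pq: "\<not> p \<rightarrow> r" "p \<noteq> q" "r \<noteq> v"
      using ind[of p 1 r] ind[of r 1 p] p r k by auto
    have "{v, p, q, r} \<subseteq> {a, b, c, d}"
      using V p q r adj_in_verts by blast
    then show False
      using pq p(2) q(2) r(2) ne adj adj' loop by auto
  qed
  have "grundy_number G = 2"
    unfolding grundy_number_def using W le2 by (intro Greatest_equality) auto
  moreover have "2 < coloring_number G"
  proof (rule min_degree_less_coloring_number)
    show "verts G \<subseteq> verts G" "verts G \<noteq> {}" using V by auto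
    fix w assume w: "w \<in> verts G"
    have "{u \<in> {a, b, c, d} - {w}. w \<rightarrow> u} = (if w \<in> {a, c} then {b, d} else {a, c})"
      using w adj adj' loop ne unfolding V by auto
    then show "2 \<le> card {u \<in> verts G - {w}. w \<rightarrow> u}"
      using ne unfolding V by simp
  qed
  ultimately show ?thesis by simp
qed

section \<open>The characterization\<close>

theorem theorem4p6:
  fixes G :: "('a, 'b) pre_digraph"
  assumes "graph G" and "verts G \<noteq> {}"
  shows "induced_free {with_proj (path_graph 4), with_proj (cycle_graph 4)} G \<longleftrightarrow>
    (\<forall>H. induced_subgraph H G \<and> verts H \<noteq> {} \<longrightarrow> grundy_number H = coloring_number H)"
    (is "induced_free ?F G \<longleftrightarrow> ?eq")
proof
  interpret graph G by fact
  assume free: "induced_free ?F G"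
  show ?eq
  proof (intro allI impI)
    fix H assume H: "induced_subgraph H G \<and> verts H \<noteq> {}"
    then interpret H: graph H using graph_induced by blast
    have "induced_free ?F H"
      using free H induced_subgraph_trans unfolding induced_free_def by blast
    then interpret H: nested_graph H
      by unfold_locales (rule H.adj_closed_nbhd_nested)
    show "grundy_number H = coloring_number H"
      using H by (intro H.grundy_number_eq_coloring_number) simp
  qed
next
  interpret graph G by fact
  assume eq: ?eq
  show "induced_free ?F G"
    unfolding induced_free_def
  proof (rule notI, elim exE conjE)
    fix H F assume H: "induced_subgraph H G" and "F \<in> ?F" "digraph_iso H F"
    then interpret H: graph H using graph_induced by blast
    from \<open>F \<in> ?F\<close> \<open>digraph_iso H F\<close>
    have iso: "digraph_iso H (with_proj (path_graph 4)) \<or> digraph_iso H (with_proj (cycle_graph 4))"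
      by auto
    then have "verts H \<noteq> {}"
      unfolding H.iso_path_4_iff H.iso_cycle_4_iff by auto
    moreover have "grundy_number H \<noteq> coloring_number H"
      using iso H.grundy_number_neq_path_4 H.grundy_number_neq_cycle_4 by blast
    ultimately show False using eq H by blast
  qed
qed

end
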